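(* Let $\mathbb{P}_\tau=(P_o,P_a,\vDash,\mathcal{F}_\tau)$ be an attribute continuous formal context. Then $(\mathfrak{B}(P_a,\mathcal{F}_\tau),\subseteq)$ is an algebraic domain if and only if the following condition holds: for all $F_1,F_2\in\mathcal{F}_\tau$ with $F_2\subseteq\lceil F_1\rceil$ there exists $F\in\mathcal{F}_\tau$ such that $F_2\subseteq\lceil F\rceil$, $F\subseteq\lceil F\rceil$ and $F\subseteq\lceil F_1\rceil$.
   Context: Domain theory. A dcpo is a poset in which every directed (nonempty, upward directed) subset has a least upper bound. In a dcpo $P$, $x\ll y$ means: for every directed $D\subseteq P$ with $y\leq\bigvee D$ there is $d\in D$ with $x\leq d$. A basis of $P$ is a subset $B\subseteq P$ such that for every $x\in P$ the set $\{b\in B: b\ll x\}$ is directed with least upper bound $x$. An element $x$ is compact if $x\ll x$. A dcpo is an algebraic domain if its set of compact elements is a basis. Notation: $M\sqsubseteq X$ means that $M$ is a finite subset of $X$ (possibly empty). A formal context is a triple $(P_o,P_a,\vDash)$ with sets $P_o$ (objects), $P_a$ (attributes) and a relation $\vDash\subseteq P_o\times P_a$. Define $\alpha(A)=\{n\in P_a:\forall m\in A,\ m\vDash n\}$ for $A\subseteq P_o$ and $\omega(B)=\{m\in P_o:\forall n\in B,\ m\vDash n\}$ for $B\subseteq P_a$. A kernel attribute operator on $(P_o,P_a,\vDash)$ is a map $\tau:\mathcal{P}(P_a)\to\mathcal{P}(P_a)$ such that for all $B,B_1\subseteq P_a$: $\tau(\alpha(\omega(B)))\subseteq\alpha(\omega(B))$;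 $\tau(\tau(\alpha(\omega(B))))=\tau(\alpha(\omega(B)))$; and $\tau(\alpha(\omega(B)))\subseteq\tau(\alpha(\omega(B_1)))$ whenever $B\subseteq B_1$. Write $\lceil B\rceil=\tau(\alpha(\omega(B)))$. A $\tau$-consistent selection is a nonempty family $\mathcal{F}_\tau$ of nonempty finite subsets of $P_a$ such that for every $F\in\mathcal{F}_\tau$ and every $M\sqsubseteq\lceil F\rceil$ there is $G\in\mathcal{F}_\tau$ with $M\subseteq\lceil G\rceil$ and $G\subseteq\lceil F\rceil$. An attribute continuous formal context is a structure $\mathbb{P}_\tau=(P_o,P_a,\vDash,\mathcal{F}_\tau)$ where $(P_o,P_a,\vDash)$ is a formal context, $\tau$ is a kernel attribute operator on it and $\mathcal{F}_\tau$ is a $\tau$-consistent selection. A continuous formal concept of $\mathbb{P}_\tau$ is a subset $Q\subseteq P_a$ such that for every $M\sqsubseteq Q$ there is $F\in\mathcal{F}_\tau$ with $M\subseteq\lceil F\rceil\subseteq Q$. The set of all of them is $\mathfrak{B}(P_a,\mathcal{F}_\tau)$. *)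

theory Defs
  imports "HOL-Algebra.Order"
begin

section \<open>Domain theory on posets with explicit carrier\<close>

definition directed_subset :: "('a, 'b) gorder_scheme \<Rightarrow> 'a set \<Rightarrow> bool" where
  "directed_subset L D \<longleftrightarrow>
     D \<subseteq> carrier L \<and> D \<noteq> {} \<and> (\<forall>x\<in>D. \<forall>y\<in>D. \<exists>z\<in>D. x \<sqsubseteq>\<^bsub>L\<^esub> z \<and> y \<sqsubseteq>\<^bsub>L\<^esub> z)"

locale dcpo = partial_order L for L (structure) +
  assumes directed_has_lub: "directed_subset L D \<Longrightarrow> \<exists>s. is_lub L s D"

text \<open>In a dcpo a directed set has exactly one least upper bound, so the \<open>s\<close> below is
  the supremum of \<open>D\<close>.\<close>

definition way_below :: "('a, 'b) gorder_scheme \<Rightarrow> 'a \<Rightarrow> 'a \<Rightarrow> bool" where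
  "way_below L x y \<longleftrightarrow>
     x \<in> carrier L \<and> y \<in> carrier L \<and>
     (\<forall>D s. directed_subset L D \<and> is_lub L s D \<and> y \<sqsubseteq>\<^bsub>L\<^esub> s \<longrightarrow> (\<exists>d\<in>D. x \<sqsubseteq>\<^bsub>L\<^esub> d))"

definition domain_basis :: "('a, 'b) gorder_scheme \<Rightarrow> 'a set \<Rightarrow> bool" where
  "domain_basis L B \<longleftrightarrow>
     B \<subseteq> carrier L \<and>
     (\<forall>x\<in>carrier L. directed_subset L {b \<in> B. way_below L b x} \<and>
                     is_lub L x {b \<in> B. way_below L b x})"

definition compact_elements :: "('a, 'b) gorder_scheme \<Rightarrow> 'a set" where
  "compact_elements L = {x \<in> carrier L. way_below L x x}"

locale algebraic_domain = dcpo L for L (structure) +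
  assumes compact_basis: "domain_basis L (compact_elements L)"

section \<open>Formal contexts and attribute continuous formal contexts\<close>

text \<open>Objects \<open>Po\<close> and attributes \<open>Pa\<close> are arbitrary (possibly empty) subsets of the
  ambient types, and \<open>(m, n) \<in> I\<close> says that object \<open>m\<close> has attribute \<open>n\<close>.\<close>

locale formal_context =
  fixes Po :: "'o set" and Pa :: "'a set" and I :: "('o \<times> 'a) set"
  assumes incidence: "I \<subseteq> Po \<times> Pa"

definition common_attributes :: "'a set \<Rightarrow> ('o \<times> 'a) set \<Rightarrow> 'o set \<Rightarrow> 'a set" where
  "common_attributes Pa I A = {n \<in> Pa. \<forall>m\<in>A. (m, n) \<in> I}"

definition common_objects :: "'o set \<Rightarrow> ('o \<times> 'a) set \<Rightarrow> 'a set \<Rightarrow> 'o set" where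
  "common_objects Po I B = {m \<in> Po. \<forall>n\<in>B. (m, n) \<in> I}"

definition attribute_closure ::
    "'o set \<Rightarrow> 'a set \<Rightarrow> ('o \<times> 'a) set \<Rightarrow> 'a set \<Rightarrow> 'a set" where
  "attribute_closure Po Pa I B = common_attributes Pa I (common_objects Po I B)"

locale kernel_attribute_operator = formal_context Po Pa I
  for Po :: "'o set" and Pa :: "'a set" and I :: "('o \<times> 'a) set" +
  fixes \<tau> :: "'a set \<Rightarrow> 'a set"
  assumes maps_to: "\<tau> \<in> Pow Pa \<rightarrow> Pow Pa"
    and contractive: "B \<subseteq> Pa \<Longrightarrow>
      \<tau> (attribute_closure Po Pa I B) \<subseteq> attribute_closure Po Pa I B"
    and idempotent: "B \<subseteq> Pa \<Longrightarrow>
      \<tau> (\<tau> (attribute_closure Po Pa I B)) = \<tau> (attribute_closure Po Pa I B)"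
    and monotone: "\<lbrakk>B \<subseteq> Pa; B\<^sub>1 \<subseteq> Pa; B \<subseteq> B\<^sub>1\<rbrakk> \<Longrightarrow>
      \<tau> (attribute_closure Po Pa I B) \<subseteq> \<tau> (attribute_closure Po Pa I B\<^sub>1)"

text \<open>The set written \<open>\<lceil>B\<rceil>\<close> in the literature.\<close>

definition kernel_closure ::
    "'o set \<Rightarrow> 'a set \<Rightarrow> ('o \<times> 'a) set \<Rightarrow> ('a set \<Rightarrow> 'a set) \<Rightarrow> 'a set \<Rightarrow> 'a set" where
  "kernel_closure Po Pa I \<tau> B = \<tau> (attribute_closure Po Pa I B)"

definition consistent_selection ::
    "'o set \<Rightarrow> 'a set \<Rightarrow> ('o \<times> 'a) set \<Rightarrow> ('a set \<Rightarrow> 'a set) \<Rightarrow> 'a set set \<Rightarrow> bool" where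
  "consistent_selection Po Pa I \<tau> \<F> \<longleftrightarrow>
     \<F> \<noteq> {} \<and>
     (\<forall>F\<in>\<F>. F \<noteq> {} \<and> finite F \<and> F \<subseteq> Pa) \<and>
     (\<forall>F\<in>\<F>. \<forall>M. finite M \<and> M \<subseteq> kernel_closure Po Pa I \<tau> F \<longrightarrow>
        (\<exists>G\<in>\<F>. M \<subseteq> kernel_closure Po Pa I \<tau> G \<and> G \<subseteq> kernel_closure Po Pa I \<tau> F))"

locale attribute_continuous_context = kernel_attribute_operator Po Pa I \<tau>
  for Po :: "'o set" and Pa :: "'a set" and I :: "('o \<times> 'a) set"
    and \<tau> :: "'a set \<Rightarrow> 'a set" +
  fixes \<F> :: "'a set set"
  assumes selection: "consistent_selection Po Pa I \<tau> \<F>"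

definition continuous_concepts ::
    "'o set \<Rightarrow> 'a set \<Rightarrow> ('o \<times> 'a) set \<Rightarrow> ('a set \<Rightarrow> 'a set) \<Rightarrow> 'a set set \<Rightarrow> 'a set set" where
  "continuous_concepts Po Pa I \<tau> \<F> =
     {Q. Q \<subseteq> Pa \<and> (\<forall>M. finite M \<and> M \<subseteq> Q \<longrightarrow>
        (\<exists>F\<in>\<F>. M \<subseteq> kernel_closure Po Pa I \<tau> F \<and> kernel_closure Po Pa I \<tau> F \<subseteq> Q))}"

definition inclusion_order :: "'a set set \<Rightarrow> 'a set gorder" where
  "inclusion_order \<A> = \<lparr>carrier = \<A>, eq = (=), le = (\<subseteq>)\<rparr>"

end

theory Submission
  imports Defs
begin

text \<open>Every concept \<open>Q\<close> is the directed union of the concepts \<open>\<lceil>F\<rceil>\<close> with \<open>F \<in> \<F>\<close> and \<open>F \<subseteq> Q\<close>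
  (requiring \<open>F \<subseteq> Q\<close> rather than only \<open>\<lceil>F\<rceil> \<subseteq> Q\<close> makes the union directed), and directed suprema
  of concepts are unions. Hence \<open>X \<lless> Q\<close> iff \<open>X \<subseteq> \<lceil>F\<rceil>\<close> for such an \<open>F\<close>, and the compact
  concepts are the \<open>\<lceil>F\<rceil>\<close> with \<open>F \<subseteq> \<lceil>F\<rceil>\<close>. Algebraicity therefore means that the compact
  \<open>\<lceil>F\<rceil> \<subseteq> Q\<close> absorb the finite subsets of \<open>Q\<close>, which for \<open>Q = \<lceil>F\<^sub>1\<rceil>\<close> is the stated condition;
  consistency of the selection reduces general \<open>Q\<close> to this case.\<close>

section \<open>Families of sets ordered by inclusion\<close>

lemma carrier_inclusion_order [simp]: "carrier (inclusion_order \<A>) = \<A>"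
  by (simp add: inclusion_order_def)

lemma le_inclusion_order [simp]: "X \<sqsubseteq>\<^bsub>inclusion_order \<A>\<^esub> Y \<longleftrightarrow> X \<subseteq> Y"
  by (simp add: inclusion_order_def)

lemma partial_order_inclusion_order: "partial_order (inclusion_order \<A>)"
  by unfold_locales (auto simp: inclusion_order_def)

lemma Upper_inclusion_order:
  assumes "D \<subseteq> \<A>"
  shows "Upper (inclusion_order \<A>) D = {U \<in> \<A>. \<Union>D \<subseteq> U}"
  using assms unfolding Upper_def carrier_inclusion_order le_inclusion_order by blast

lemma is_lub_Union:
  assumes "D \<subseteq> \<A>" "\<Union>D \<in> \<A>"
  shows "is_lub (inclusion_order \<A>) S D \<longleftrightarrow> S = \<Union>D"
  using assms(2) unfolding least_def Upper_inclusion_order[OF assms(1)] by auto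

lemma directed_subset_inclusion_order:
  "directed_subset (inclusion_order \<A>) D \<longleftrightarrow>
    D \<subseteq> \<A> \<and> D \<noteq> {} \<and> (\<forall>X\<in>D. \<forall>Y\<in>D. \<exists>Z\<in>D. X \<subseteq> Z \<and> Y \<subseteq> Z)"
  by (simp add: directed_subset_def)

text \<open>Directedness merges the members covering \<open>M\<close> one point at a time; for empty
  \<open>M\<close> the nonemptiness of \<open>D\<close> supplies the member.\<close>

lemma finite_subset_directed_Union:
  assumes "directed_subset (inclusion_order \<A>) D" "finite M" "M \<subseteq> \<Union>D"
  shows "\<exists>X\<in>D. M \<subseteq> X"
  using assms(2,3)
proof (induction M rule: finite_induct)
  case empty
  then show ?case
    using assms(1) by (auto simp: directed_subset_inclusion_order)
next
  case (insert x M)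
  then obtain X Y where "X \<in> D" "M \<subseteq> X" "Y \<in> D" "x \<in> Y"
    by auto
  moreover from this obtain Z where "Z \<in> D" "X \<subseteq> Z" "Y \<subseteq> Z"
    using assms(1) unfolding directed_subset_inclusion_order by meson
  ultimately show ?case
    by blast
qed

section \<open>Attribute closure and the kernel operator\<close>

lemma attribute_closure_subset: "attribute_closure Po Pa I B \<subseteq> Pa"
  by (auto simp: attribute_closure_def common_attributes_def)

lemma attribute_closure_idem:
  "attribute_closure Po Pa I (attribute_closure Po Pa I B) = attribute_closure Po Pa I B"
  by (auto simp: attribute_closure_def common_attributes_def common_objects_def)

context kernel_attribute_operator
begin

abbreviation ceil :: "'a set \<Rightarrow> 'a set" ("\<lceil>_\<rceil>") where
  "\<lceil>B\<rceil> \<equiv> kernel_closure Po Pa I \<tau> B"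

lemma kernel_closure_subset: "\<lceil>B\<rceil> \<subseteq> Pa"
  using funcset_mem[OF maps_to] attribute_closure_subset
  by (metis PowD PowI kernel_closure_def)

text \<open>Contractivity places \<open>G\<close> inside the attribute closure of \<open>F\<close>;
  monotonicity of \<tau> and idempotence of the attribute closure then give the inclusion. Note that
  \<open>F\<close> itself may fail to lie in \<open>\<lceil>F\<rceil>\<close>.\<close>

lemma kernel_closure_least:
  assumes "F \<subseteq> Pa" "G \<subseteq> \<lceil>F\<rceil>"
  shows "\<lceil>G\<rceil> \<subseteq> \<lceil>F\<rceil>"
proof -
  have "G \<subseteq> attribute_closure Po Pa I F"
    using assms contractive unfolding kernel_closure_def by blast
  then have "\<tau> (attribute_closure Po Pa I G)
      \<subseteq> \<tau> (attribute_closure Po Pa I (attribute_closure Po Pa I F))"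
    by (meson attribute_closure_subset monotone order_trans)
  then show ?thesis
    by (simp add: kernel_closure_def attribute_closure_idem)
qed

end

section \<open>The dcpo of continuous concepts\<close>

context attribute_continuous_context
begin

abbreviation concepts :: "'a set set" where
  "concepts \<equiv> continuous_concepts Po Pa I \<tau> \<F>"

abbreviation concept_order :: "'a set gorder" where
  "concept_order \<equiv> inclusion_order concepts"

lemma selection_finite: "F \<in> \<F> \<Longrightarrow> finite F"
  and selection_subset: "F \<in> \<F> \<Longrightarrow> F \<subseteq> Pa"
  using selection by (auto simp: consistent_selection_def)

lemma selection_interpolation:
  assumes "F \<in> \<F>" "finite M" "M \<subseteq> \<lceil>F\<rceil>"
  obtains G where "G \<in> \<F>" "M \<subseteq> \<lceil>G\<rceil>" "G \<subseteq> \<lceil>F\<rceil>"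
  using selection assms unfolding consistent_selection_def by meson

lemma selection_closure_least: "F \<in> \<F> \<Longrightarrow> G \<subseteq> \<lceil>F\<rceil> \<Longrightarrow> \<lceil>G\<rceil> \<subseteq> \<lceil>F\<rceil>"
  using kernel_closure_least selection_subset by blast

lemma closure_in_concepts:
  assumes "F \<in> \<F>"
  shows "\<lceil>F\<rceil> \<in> concepts"
proof -
  have "\<exists>G\<in>\<F>. M \<subseteq> \<lceil>G\<rceil> \<and> \<lceil>G\<rceil> \<subseteq> \<lceil>F\<rceil>" if "finite M" "M \<subseteq> \<lceil>F\<rceil>" for M
    using selection_interpolation[OF assms that] selection_closure_least[OF assms] by metis
  then show ?thesis
    using kernel_closure_subset by (simp add: continuous_concepts_def)
qed

lemma conceptE:
  assumes "Q \<in> concepts" "finite M" "M \<subseteq> Q"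
  obtains F where "F \<in> \<F>" "M \<subseteq> \<lceil>F\<rceil>" "\<lceil>F\<rceil> \<subseteq> Q"
  using assms unfolding continuous_concepts_def by blast

text \<open>Sharpens \<open>conceptE\<close>: having \<open>\<lceil>F\<rceil> \<subseteq> Q\<close>
  does not put \<open>F\<close> inside \<open>Q\<close>, but interpolating between \<open>M\<close>
  and \<open>F\<close> yields a selected set that does lie in \<open>Q\<close>.\<close>

lemma concept_absorb:
  assumes "Q \<in> concepts" "finite M" "M \<subseteq> Q"
  obtains F where "F \<in> \<F>" "M \<subseteq> \<lceil>F\<rceil>" "F \<subseteq> Q"
proof -
  from assms obtain F where F: "F \<in> \<F>" "M \<subseteq> \<lceil>F\<rceil>" "\<lceil>F\<rceil> \<subseteq> Q"
    by (rule conceptE)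
  from F(1) assms(2) F(2) obtain G where "G \<in> \<F>" "M \<subseteq> \<lceil>G\<rceil>" "G \<subseteq> \<lceil>F\<rceil>"
    by (rule selection_interpolation)
  with F(3) show thesis
    using that by blast
qed

text \<open>The finite set \<open>F\<close> is itself a legitimate test set for the concept
  \<open>Q\<close>, so some \<open>\<lceil>G\<rceil>\<close> separates it from \<open>Q\<close> and
  also contains \<open>\<lceil>F\<rceil>\<close>.\<close>

lemma closure_subset_concept:
  assumes "Q \<in> concepts" "F \<in> \<F>" "F \<subseteq> Q"
  shows "\<lceil>F\<rceil> \<subseteq> Q"
proof -
  from assms(1) selection_finite[OF assms(2)] assms(3)
  obtain G where "G \<in> \<F>" "F \<subseteq> \<lceil>G\<rceil>" "\<lceil>G\<rceil> \<subseteq> Q"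
    by (rule conceptE)
  then show ?thesis
    using selection_closure_least by blast
qed

lemma directed_Union_in_concepts:
  assumes "directed_subset concept_order D"
  shows "\<Union>D \<in> concepts"
proof -
  have D: "D \<subseteq> concepts"
    using assms by (simp add: directed_subset_inclusion_order)
  have "\<exists>F\<in>\<F>. M \<subseteq> \<lceil>F\<rceil> \<and> \<lceil>F\<rceil> \<subseteq> \<Union>D" if M: "finite M" "M \<subseteq> \<Union>D" for M
  proof -
    \<comment> \<open>Concepthood is tested on finite sets only, and a finite subset of a directed
      union already lies in one member.\<close>
    obtain X where "X \<in> D" "M \<subseteq> X"
      using finite_subset_directed_Union[OF assms M] by blast
    moreover from this D have "X \<in> concepts"
      by blast
    ultimately obtain F where "F \<in> \<F>" "M \<subseteq> \<lceil>F\<rceil>" "\<lceil>F\<rceil> \<subseteq> X"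
      using M(1) by (meson conceptE)
    with \<open>X \<in> D\<close> show ?thesis
      by blast
  qed
  moreover have "\<Union>D \<subseteq> Pa"
    using D by (auto simp: continuous_concepts_def)
  ultimately show ?thesis
    by (simp add: continuous_concepts_def)
qed

lemma is_lub_directed:
  assumes "directed_subset concept_order D"
  shows "is_lub concept_order S D \<longleftrightarrow> S = \<Union>D"
  using assms
  by (intro is_lub_Union directed_Union_in_concepts) (simp_all add: directed_subset_inclusion_order)

lemma dcpo_concept_order: "dcpo concept_order"
  using partial_order_inclusion_order is_lub_directed
  by (auto simp: dcpo_def dcpo_axioms_def)

lemma directed_closures:
  assumes "Q \<in> concepts"
  shows "directed_subset concept_order {\<lceil>F\<rceil> | F. F \<in> \<F> \<and> F \<subseteq> Q}"
    (is "directed_subset _ ?D")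
  unfolding directed_subset_inclusion_order
proof (intro conjI ballI)
  show "?D \<subseteq> concepts"
    using closure_in_concepts by blast
  show "?D \<noteq> {}"
    by (rule concept_absorb[OF assms, of "{}"]) auto
next
  fix X Y
  assume "X \<in> ?D" "Y \<in> ?D"
  then obtain F G where FG: "X = \<lceil>F\<rceil>" "Y = \<lceil>G\<rceil>" "F \<in> \<F>" "G \<in> \<F>" "F \<subseteq> Q" "G \<subseteq> Q"
    by blast
  \<comment> \<open>Since the sets \<open>F\<close> and \<open>G\<close>, not just their closures,
    lie in \<open>Q\<close>, their finite union can be absorbed.\<close>
  then have "finite (F \<union> G)" "F \<union> G \<subseteq> Q"
    using selection_finite by auto
  with assms obtain H where H: "H \<in> \<F>" "F \<union> G \<subseteq> \<lceil>H\<rceil>" "H \<subseteq> Q"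
    by (rule concept_absorb)
  then have "X \<subseteq> \<lceil>H\<rceil>" "Y \<subseteq> \<lceil>H\<rceil>"
    unfolding FG(1,2) using selection_closure_least[OF H(1)] by simp_all
  with H show "\<exists>Z\<in>?D. X \<subseteq> Z \<and> Y \<subseteq> Z"
    by blast
qed

lemma Union_closures:
  assumes "Q \<in> concepts"
  shows "\<Union>{\<lceil>F\<rceil> | F. F \<in> \<F> \<and> F \<subseteq> Q} = Q"
proof
  show "\<Union>{\<lceil>F\<rceil> | F. F \<in> \<F> \<and> F \<subseteq> Q} \<subseteq> Q"
    using closure_subset_concept[OF assms] by blast
next
  show "Q \<subseteq> \<Union>{\<lceil>F\<rceil> | F. F \<in> \<F> \<and> F \<subseteq> Q}"
  proof
    fix x
    assume "x \<in> Q"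
    then have "finite {x}" "{x} \<subseteq> Q"
      by simp_all
    with assms obtain F where "F \<in> \<F>" "{x} \<subseteq> \<lceil>F\<rceil>" "F \<subseteq> Q"
      by (rule concept_absorb)
    then show "x \<in> \<Union>{\<lceil>F\<rceil> | F. F \<in> \<F> \<and> F \<subseteq> Q}"
      by blast
  qed
qed

section \<open>Way-below, compactness and algebraicity\<close>

lemma way_below_concept_iff:
  "way_below concept_order X Q \<longleftrightarrow>
    X \<in> concepts \<and> Q \<in> concepts \<and> (\<exists>F\<in>\<F>. F \<subseteq> Q \<and> X \<subseteq> \<lceil>F\<rceil>)"
proof (intro iffI; (elim conjE bexE)?)
  assume wb: "way_below concept_order X Q"
  then have "X \<in> concepts" and Q: "Q \<in> concepts"
    by (simp_all add: way_below_def)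
  \<comment> \<open>Testing the way-below relation on this one canonical directed family produces
    the witness \<open>F\<close>.\<close>
  moreover have "is_lub concept_order Q {\<lceil>F\<rceil> | F. F \<in> \<F> \<and> F \<subseteq> Q}"
    using is_lub_directed[OF directed_closures[OF Q]] Union_closures[OF Q] by simp
  then have "\<exists>Y\<in>{\<lceil>F\<rceil> | F. F \<in> \<F> \<and> F \<subseteq> Q}. X \<subseteq> Y"
    using wb directed_closures[OF Q] unfolding way_below_def le_inclusion_order by blast
  ultimately show "X \<in> concepts \<and> Q \<in> concepts \<and> (\<exists>F\<in>\<F>. F \<subseteq> Q \<and> X \<subseteq> \<lceil>F\<rceil>)"
    by blast
next
  fix F
  assume X: "X \<in> concepts" "Q \<in> concepts" and F: "F \<in> \<F>" "F \<subseteq> Q" "X \<subseteq> \<lceil>F\<rceil>"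
  have "\<exists>d\<in>D. X \<subseteq> d" if D: "directed_subset concept_order D" "Q \<subseteq> \<Union>D" for D
  proof -
    \<comment> \<open>The finite set \<open>F\<close> falls into a single member \<open>d\<close>,
      and as \<open>d\<close> is a concept it then contains \<open>\<lceil>F\<rceil>\<close>, hence
      \<open>X\<close>.\<close>
    have "F \<subseteq> \<Union>D"
      using F(2) D(2) by (rule order_trans)
    then obtain d where d: "d \<in> D" "F \<subseteq> d"
      using finite_subset_directed_Union[OF D(1) selection_finite[OF F(1)]] by blast
    moreover have "d \<in> concepts"
      using D(1) d(1) by (auto simp: directed_subset_inclusion_order)
    then have "\<lceil>F\<rceil> \<subseteq> d"
      using F(1) d(2) by (rule closure_subset_concept)
    ultimately show ?thesis
      using F(3) by blast
  qed
  then show "way_below concept_order X Q"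
    using X is_lub_directed by (auto simp: way_below_def)
qed

text \<open>Taking \<open>Q = X\<close> in \<open>way_below_concept_iff\<close> squeezes
  \<open>X\<close> between \<open>F\<close> and \<open>\<lceil>F\<rceil>\<close>, and a concept
  containing \<open>F\<close> contains \<open>\<lceil>F\<rceil>\<close>. Conversely,
  \<open>F\<close> is its own witness.\<close>

lemma compact_concepts:
  "compact_elements concept_order = {\<lceil>F\<rceil> | F. F \<in> \<F> \<and> F \<subseteq> \<lceil>F\<rceil>}"
proof (intro equalityI subsetI)
  fix X
  assume "X \<in> compact_elements concept_order"
  then obtain F where F: "X \<in> concepts" "F \<in> \<F>" "F \<subseteq> X" "X \<subseteq> \<lceil>F\<rceil>"
    by (auto simp: compact_elements_def way_below_concept_iff)
  then have "X = \<lceil>F\<rceil>"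
    by (simp add: closure_subset_concept subset_antisym)
  with F show "X \<in> {\<lceil>F\<rceil> | F. F \<in> \<F> \<and> F \<subseteq> \<lceil>F\<rceil>}"
    by auto
next
  fix X
  assume "X \<in> {\<lceil>F\<rceil> | F. F \<in> \<F> \<and> F \<subseteq> \<lceil>F\<rceil>}"
  then show "X \<in> compact_elements concept_order"
    by (auto simp: compact_elements_def way_below_concept_iff closure_in_concepts)
qed

text \<open>For a compact \<open>\<lceil>F\<rceil>\<close>, way-below reduces to inclusion:
  \<open>F \<subseteq> \<lceil>F\<rceil> \<subseteq> Q\<close> makes \<open>F\<close> the required
  witness.\<close>

lemma compacts_way_below_concept:
  assumes "Q \<in> concepts"
  shows "{X \<in> compact_elements concept_order. way_below concept_order X Q}
    = {\<lceil>F\<rceil> | F. F \<in> \<F> \<and> F \<subseteq> \<lceil>F\<rceil> \<and> \<lceil>F\<rceil> \<subseteq> Q}"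
proof -
  have "way_below concept_order \<lceil>F\<rceil> Q \<longleftrightarrow> \<lceil>F\<rceil> \<subseteq> Q" if F: "F \<in> \<F>" "F \<subseteq> \<lceil>F\<rceil>" for F
  proof
    assume "way_below concept_order \<lceil>F\<rceil> Q"
    then obtain G where "G \<in> \<F>" "G \<subseteq> Q" "\<lceil>F\<rceil> \<subseteq> \<lceil>G\<rceil>"
      by (auto simp: way_below_concept_iff)
    then show "\<lceil>F\<rceil> \<subseteq> Q"
      using closure_subset_concept[OF assms] by (meson order_trans)
  next
    assume "\<lceil>F\<rceil> \<subseteq> Q"
    then have "F \<subseteq> Q"
      using F(2) by simp
    then show "way_below concept_order \<lceil>F\<rceil> Q"
      using F(1) assms closure_in_concepts by (auto simp: way_below_concept_iff)
  qed
  then show ?thesis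
    unfolding compact_concepts by auto
qed

lemma algebraic_domain_concepts_iff:
  "algebraic_domain concept_order \<longleftrightarrow>
    (\<forall>Q\<in>concepts. \<forall>M. finite M \<and> M \<subseteq> Q \<longrightarrow>
      (\<exists>F\<in>\<F>. M \<subseteq> \<lceil>F\<rceil> \<and> F \<subseteq> \<lceil>F\<rceil> \<and> \<lceil>F\<rceil> \<subseteq> Q))"
    (is "_ \<longleftrightarrow> (\<forall>Q\<in>concepts. ?absorbs Q)")
proof -
  \<comment> \<open>For a concept \<open>Q\<close> these are the compact concepts way below
    \<open>Q\<close>, so the basis condition can be compared with absorption separately for each
    \<open>Q\<close>.\<close>
  define K where "K Q = {\<lceil>F\<rceil> | F. F \<in> \<F> \<and> F \<subseteq> \<lceil>F\<rceil> \<and> \<lceil>F\<rceil> \<subseteq> Q}" for Q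
  have "directed_subset concept_order (K Q) \<and> is_lub concept_order Q (K Q) \<longleftrightarrow> ?absorbs Q"
    if "Q \<in> concepts" for Q
  proof
    assume K: "directed_subset concept_order (K Q) \<and> is_lub concept_order Q (K Q)"
    then have "Q = \<Union>(K Q)"
      using is_lub_directed by blast
    then have "\<exists>X\<in>K Q. M \<subseteq> X" if "finite M" "M \<subseteq> Q" for M
      using finite_subset_directed_Union[of concepts "K Q" M] K that by simp
    moreover have "\<exists>F\<in>\<F>. M \<subseteq> \<lceil>F\<rceil> \<and> F \<subseteq> \<lceil>F\<rceil> \<and> \<lceil>F\<rceil> \<subseteq> Q"
      if "X \<in> K Q" "M \<subseteq> X" for X M
      using that by (auto simp: K_def)
    ultimately show "?absorbs Q"
      by meson
  next
    assume absorbs: "?absorbs Q"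
    have directed: "directed_subset concept_order (K Q)"
      unfolding directed_subset_inclusion_order
    proof (intro conjI ballI)
      show "K Q \<subseteq> concepts"
        using closure_in_concepts by (auto simp: K_def)
      \<comment> \<open>Absorbing the empty set gives a member; below, absorbing
        \<open>F \<union> G\<close> gives upper bounds and absorbing singletons shows that the union
        is all of \<open>Q\<close>.\<close>
      show "K Q \<noteq> {}"
        using absorbs[THEN spec, of "{}"] by (auto simp: K_def)
    next
      fix X Y
      assume "X \<in> K Q" "Y \<in> K Q"
      then obtain F G where FG: "X = \<lceil>F\<rceil>" "Y = \<lceil>G\<rceil>" "F \<in> \<F>" "G \<in> \<F>" "F \<union> G \<subseteq> Q"
        unfolding K_def by blast
      then have "finite (F \<union> G)"
        using selection_finite by simp
      with FG(5) obtain H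
        where H: "H \<in> \<F>" "F \<union> G \<subseteq> \<lceil>H\<rceil>" "H \<subseteq> \<lceil>H\<rceil>" "\<lceil>H\<rceil> \<subseteq> Q"
        using absorbs by meson
      then have "X \<subseteq> \<lceil>H\<rceil>" "Y \<subseteq> \<lceil>H\<rceil>"
        unfolding FG(1,2) using selection_closure_least[OF H(1)] by simp_all
      with H show "\<exists>Z\<in>K Q. X \<subseteq> Z \<and> Y \<subseteq> Z"
        unfolding K_def by blast
    qed
    have "x \<in> \<Union>(K Q)" if "x \<in> Q" for x
      using absorbs[THEN spec, of "{x}"] that by (auto simp: K_def)
    then have "Q = \<Union>(K Q)"
      by (auto simp: K_def)
    with directed show "directed_subset concept_order (K Q) \<and> is_lub concept_order Q (K Q)"
      using is_lub_directed by blast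
  qed
  moreover have "compact_elements concept_order \<subseteq> concepts"
    by (auto simp: compact_elements_def)
  ultimately show ?thesis
    unfolding algebraic_domain_def algebraic_domain_axioms_def domain_basis_def K_def
    using dcpo_concept_order by (simp add: compacts_way_below_concept cong: ball_cong)
qed

lemma absorption_iff_interpolation:
  "(\<forall>Q\<in>concepts. \<forall>M. finite M \<and> M \<subseteq> Q \<longrightarrow>
      (\<exists>F\<in>\<F>. M \<subseteq> \<lceil>F\<rceil> \<and> F \<subseteq> \<lceil>F\<rceil> \<and> \<lceil>F\<rceil> \<subseteq> Q)) \<longleftrightarrow>
    (\<forall>F\<^sub>1\<in>\<F>. \<forall>F\<^sub>2\<in>\<F>. F\<^sub>2 \<subseteq> \<lceil>F\<^sub>1\<rceil> \<longrightarrow>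
      (\<exists>F\<in>\<F>. F\<^sub>2 \<subseteq> \<lceil>F\<rceil> \<and> F \<subseteq> \<lceil>F\<rceil> \<and> F \<subseteq> \<lceil>F\<^sub>1\<rceil>))"
    (is "?absorption \<longleftrightarrow> ?interpolation")
proof
  assume absorption: ?absorption
  show ?interpolation
  proof (intro ballI impI)
    fix F\<^sub>1 F\<^sub>2
    assume "F\<^sub>1 \<in> \<F>" "F\<^sub>2 \<in> \<F>" "F\<^sub>2 \<subseteq> \<lceil>F\<^sub>1\<rceil>"
    \<comment> \<open>Absorption is applied to the concept \<open>\<lceil>F\<^sub>1\<rceil>\<close>
      and its finite subset \<open>F\<^sub>2\<close>.\<close>
    then obtain F where "F \<in> \<F>" "F\<^sub>2 \<subseteq> \<lceil>F\<rceil>" "F \<subseteq> \<lceil>F\<rceil>" "\<lceil>F\<rceil> \<subseteq> \<lceil>F\<^sub>1\<rceil>"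
      using absorption closure_in_concepts selection_finite by meson
    then show "\<exists>F\<in>\<F>. F\<^sub>2 \<subseteq> \<lceil>F\<rceil> \<and> F \<subseteq> \<lceil>F\<rceil> \<and> F \<subseteq> \<lceil>F\<^sub>1\<rceil>"
      by blast
  qed
next
  assume interpolation: ?interpolation
  show ?absorption
  proof (intro ballI allI impI; elim conjE)
    fix Q M
    assume Q: "Q \<in> concepts" and M: "finite M" "M \<subseteq> Q"
    then obtain F\<^sub>1 where F\<^sub>1: "F\<^sub>1 \<in> \<F>" "M \<subseteq> \<lceil>F\<^sub>1\<rceil>" "F\<^sub>1 \<subseteq> Q"
      by (rule concept_absorb)
    \<comment> \<open>The condition concerns selected sets, whereas \<open>M\<close> is arbitrary;
      \<open>F\<^sub>2\<close> stands in for it, giving the chain \<open>M \<subseteq>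
      \<lceil>F\<^sub>2\<rceil> \<subseteq> \<lceil>F\<rceil> \<subseteq> \<lceil>F\<^sub>1\<rceil>
      \<subseteq> Q\<close>.\<close>
    from F\<^sub>1(1) M(1) F\<^sub>1(2) obtain F\<^sub>2 where F\<^sub>2: "F\<^sub>2 \<in> \<F>" "M \<subseteq> \<lceil>F\<^sub>2\<rceil>" "F\<^sub>2 \<subseteq> \<lceil>F\<^sub>1\<rceil>"
      by (rule selection_interpolation)
    with F\<^sub>1(1) interpolation obtain F
      where F: "F \<in> \<F>" "F\<^sub>2 \<subseteq> \<lceil>F\<rceil>" "F \<subseteq> \<lceil>F\<rceil>" "F \<subseteq> \<lceil>F\<^sub>1\<rceil>"
      by meson
    have "M \<subseteq> \<lceil>F\<rceil>"
      using F\<^sub>2(2) selection_closure_least[OF F(1,2)] by blast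
    moreover have "\<lceil>F\<rceil> \<subseteq> Q"
      using selection_closure_least[OF F\<^sub>1(1) F(4)] closure_subset_concept[OF Q F\<^sub>1(1,3)]
      by blast
    ultimately show "\<exists>F\<in>\<F>. M \<subseteq> \<lceil>F\<rceil> \<and> F \<subseteq> \<lceil>F\<rceil> \<and> \<lceil>F\<rceil> \<subseteq> Q"
      using F by blast
  qed
qed

end

theorem proposition3p16:
  fixes Po :: "'o set" and Pa :: "'a set" and I :: "('o \<times> 'a) set"
    and \<tau> :: "'a set \<Rightarrow> 'a set" and \<F> :: "'a set set"
  assumes "attribute_continuous_context Po Pa I \<tau> \<F>"
  shows "algebraic_domain (inclusion_order (continuous_concepts Po Pa I \<tau> \<F>)) \<longleftrightarrow>
    (\<forall>F\<^sub>1\<in>\<F>. \<forall>F\<^sub>2\<in>\<F>. F\<^sub>2 \<subseteq> kernel_closure Po Pa I \<tau> F\<^sub>1 \<longrightarrow>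
      (\<exists>F\<in>\<F>. F\<^sub>2 \<subseteq> kernel_closure Po Pa I \<tau> F \<and>
               F \<subseteq> kernel_closure Po Pa I \<tau> F \<and>
               F \<subseteq> kernel_closure Po Pa I \<tau> F\<^sub>1))"
proof -
  interpret attribute_continuous_context Po Pa I \<tau> \<F>
    by (fact assms)
  show ?thesis
    by (simp only: algebraic_domain_concepts_iff absorption_iff_interpolation)
qed

end
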